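(* Let $k$ be a field, $\mathfrak{h}$ a Lie algebra over $k$, $G$ a finite cyclic group generated by an element $\gamma$ whose order $n$ is invertible in $k$, and $\varphi:G\to\mathrm{Aut}_{\mathrm{Lie}}(\mathfrak{h})$ a $\gamma$-abelian morphism of groups. Then the map $$\mathfrak{h}^G\rtimes\mathfrak{h}_{\gamma}\to\mathfrak{h},\qquad(g,x)\mapsto g+x\qquad(g\in\mathfrak{h}^G,\ x\in\mathfrak{h}_{\gamma})$$ is an isomorphism of Lie algebras, where $\mathfrak{h}^G\rtimes\mathfrak{h}_{\gamma}$ is the semidirect product of Lie algebras associated to the right action $\leftharpoonup:\mathfrak{h}_{\gamma}\times\mathfrak{h}^G\to\mathfrak{h}_{\gamma}$ given by $x\leftharpoonup g:=[x,g]$.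
   Context: Notation: $g\triangleright x:=\varphi(g)(x)$ for $g\in G$, $x\in\mathfrak{h}$. The subalgebra of invariants is $\mathfrak{h}^G:=\{x\in\mathfrak{h}\mid g\triangleright x=x\ \forall g\in G\}$, and $\mathfrak{h}_{\gamma}:=\{y-\gamma\triangleright y\mid y\in\mathfrak{h}\}$, with the Lie bracket of $\mathfrak{h}$. The action $\varphi$ is called $\gamma$-abelian if $[g\triangleright z,\ g'\triangleright z']=0$ for all $g\neq g'$ in $G$ and all $z,z'\in\mathfrak{h}_{\gamma}$. Semidirect product of Lie algebras (right-hand convention): for Lie algebras $\mathfrak{g}$ and $V$ with a right Lie action $\leftharpoonup:V\times\mathfrak{g}\to V$ by derivations of $V$ (bilinear, $x\leftharpoonup[a,b]=(x\leftharpoonup a)\leftharpoonup b-(x\leftharpoonup b)\leftharpoonup a$, and $[x,y]\leftharpoonup a=[x,y\leftharpoonup a]+[x\leftharpoonup a,y]$), $\mathfrak{g}\rtimes V$ is the vector space $\mathfrak{g}\times V$ with bracket $[(a,x),(b,y)]:=([a,b],\ [x,y]+x\leftharpoonup b-y\leftharpoonup a)$; it contains $\{0\}\times V$ as an ideal. *)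

theory Defs
  imports "HOL-Algebra.Algebra"
begin

text \<open>
  Lie algebras are carried by the records of the library's modules: the multiplication
  \<open>\<otimes>\<^bsub>L\<^esub>\<close> of the record is the Lie bracket, so \<open>x \<otimes>\<^bsub>L\<^esub> y\<close> stands for \<open>[x, y]\<close>.
  It is not associative, and the field \<open>\<one>\<^bsub>L\<^esub>\<close> of the record carries no meaning.
\<close>

locale lie_algebra = K?: field K + L?: module K L for K (structure) and L (structure) +
  assumes bracket_closed [simp, intro]:
      "\<lbrakk>x \<in> carrier L; y \<in> carrier L\<rbrakk> \<Longrightarrow> x \<otimes>\<^bsub>L\<^esub> y \<in> carrier L"
    and bracket_add_left:
      "\<lbrakk>x \<in> carrier L; y \<in> carrier L; z \<in> carrier L\<rbrakk> \<Longrightarrow>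
       (x \<oplus>\<^bsub>L\<^esub> y) \<otimes>\<^bsub>L\<^esub> z = x \<otimes>\<^bsub>L\<^esub> z \<oplus>\<^bsub>L\<^esub> y \<otimes>\<^bsub>L\<^esub> z"
    and bracket_add_right:
      "\<lbrakk>x \<in> carrier L; y \<in> carrier L; z \<in> carrier L\<rbrakk> \<Longrightarrow>
       x \<otimes>\<^bsub>L\<^esub> (y \<oplus>\<^bsub>L\<^esub> z) = x \<otimes>\<^bsub>L\<^esub> y \<oplus>\<^bsub>L\<^esub> x \<otimes>\<^bsub>L\<^esub> z"
    and bracket_smult_left:
      "\<lbrakk>c \<in> carrier K; x \<in> carrier L; y \<in> carrier L\<rbrakk> \<Longrightarrow>
       (c \<odot>\<^bsub>L\<^esub> x) \<otimes>\<^bsub>L\<^esub> y = c \<odot>\<^bsub>L\<^esub> (x \<otimes>\<^bsub>L\<^esub> y)"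
    and bracket_smult_right:
      "\<lbrakk>c \<in> carrier K; x \<in> carrier L; y \<in> carrier L\<rbrakk> \<Longrightarrow>
       x \<otimes>\<^bsub>L\<^esub> (c \<odot>\<^bsub>L\<^esub> y) = c \<odot>\<^bsub>L\<^esub> (x \<otimes>\<^bsub>L\<^esub> y)"
    and bracket_self [simp]: "x \<in> carrier L \<Longrightarrow> x \<otimes>\<^bsub>L\<^esub> x = \<zero>\<^bsub>L\<^esub>"
    and jacobi:
      "\<lbrakk>x \<in> carrier L; y \<in> carrier L; z \<in> carrier L\<rbrakk> \<Longrightarrow>
       x \<otimes>\<^bsub>L\<^esub> (y \<otimes>\<^bsub>L\<^esub> z) \<oplus>\<^bsub>L\<^esub> y \<otimes>\<^bsub>L\<^esub> (z \<otimes>\<^bsub>L\<^esub> x) \<oplus>\<^bsub>L\<^esub> z \<otimes>\<^bsub>L\<^esub> (x \<otimes>\<^bsub>L\<^esub> y) = \<zero>\<^bsub>L\<^esub>"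

definition lie_subalgebra ::
    "('k, 'r) ring_scheme \<Rightarrow> 'a set \<Rightarrow> ('k, 'a, 'm) module_scheme \<Rightarrow> bool"
  where "lie_subalgebra K S L \<longleftrightarrow>
    submodule S K L \<and> (\<forall>x\<in>S. \<forall>y\<in>S. x \<otimes>\<^bsub>L\<^esub> y \<in> S)"

definition lie_hom ::
    "('k, 'r) ring_scheme \<Rightarrow> ('k, 'a, 'm) module_scheme \<Rightarrow> ('k, 'b, 'n) module_scheme \<Rightarrow> ('a \<Rightarrow> 'b) set"
  where "lie_hom K L M = {f \<in> carrier L \<rightarrow> carrier M.
    (\<forall>x\<in>carrier L. \<forall>y\<in>carrier L. f (x \<oplus>\<^bsub>L\<^esub> y) = f x \<oplus>\<^bsub>M\<^esub> f y) \<and>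
    (\<forall>c\<in>carrier K. \<forall>x\<in>carrier L. f (c \<odot>\<^bsub>L\<^esub> x) = c \<odot>\<^bsub>M\<^esub> f x) \<and>
    (\<forall>x\<in>carrier L. \<forall>y\<in>carrier L. f (x \<otimes>\<^bsub>L\<^esub> y) = f x \<otimes>\<^bsub>M\<^esub> f y)}"

definition lie_iso ::
    "('k, 'r) ring_scheme \<Rightarrow> ('k, 'a, 'm) module_scheme \<Rightarrow> ('k, 'b, 'n) module_scheme \<Rightarrow> ('a \<Rightarrow> 'b) set"
  where "lie_iso K L M = {f \<in> lie_hom K L M. bij_betw f (carrier L) (carrier M)}"

text \<open>The Lie analogue of \<open>AutoGroup\<close>; \<open>Bij\<close> makes automorphisms extensional functions.\<close>

definition LieAutGroup ::
    "('k, 'r) ring_scheme \<Rightarrow> ('k, 'a, 'm) module_scheme \<Rightarrow> ('a \<Rightarrow> 'a) monoid"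
  where "LieAutGroup K L =
    BijGroup (carrier L) \<lparr>carrier := lie_hom K L L \<inter> Bij (carrier L)\<rparr>"

definition lie_invariants ::
    "('g, 'p) monoid_scheme \<Rightarrow> ('k, 'a, 'm) module_scheme \<Rightarrow> ('g \<Rightarrow> 'a \<Rightarrow> 'a) \<Rightarrow> 'a set"
  where "lie_invariants G L \<phi> = {x \<in> carrier L. \<forall>g\<in>carrier G. \<phi> g x = x}"

definition gamma_differences ::
    "('k, 'a, 'm) module_scheme \<Rightarrow> ('g \<Rightarrow> 'a \<Rightarrow> 'a) \<Rightarrow> 'g \<Rightarrow> 'a set"
  where "gamma_differences L \<phi> \<gamma> = {y \<ominus>\<^bsub>L\<^esub> \<phi> \<gamma> y | y. y \<in> carrier L}"

definition gamma_abelian ::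
    "('g, 'p) monoid_scheme \<Rightarrow> ('k, 'a, 'm) module_scheme \<Rightarrow> ('g \<Rightarrow> 'a \<Rightarrow> 'a) \<Rightarrow> 'g \<Rightarrow> bool"
  where "gamma_abelian G L \<phi> \<gamma> \<longleftrightarrow>
    (\<forall>g\<in>carrier G. \<forall>g'\<in>carrier G. g \<noteq> g' \<longrightarrow>
      (\<forall>z\<in>gamma_differences L \<phi> \<gamma>. \<forall>z'\<in>gamma_differences L \<phi> \<gamma>.
        \<phi> g z \<otimes>\<^bsub>L\<^esub> \<phi> g' z' = \<zero>\<^bsub>L\<^esub>))"

text \<open>
  A right action of \<open>A\<close> on \<open>V\<close> by derivations; \<open>act x a\<close> is \<open>x \<leftharpoonup> a\<close>.
\<close>

locale right_lie_action = A: lie_algebra K A + V: lie_algebra K V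
  for K :: "('k, 'r) ring_scheme" and A :: "('k, 'a, 'm) module_scheme"
    and V :: "('k, 'b, 'n) module_scheme" +
  fixes act :: "'b \<Rightarrow> 'a \<Rightarrow> 'b"
  assumes act_closed [simp, intro]:
      "\<lbrakk>x \<in> carrier V; a \<in> carrier A\<rbrakk> \<Longrightarrow> act x a \<in> carrier V"
    and act_add_left:
      "\<lbrakk>x \<in> carrier V; y \<in> carrier V; a \<in> carrier A\<rbrakk> \<Longrightarrow>
       act (x \<oplus>\<^bsub>V\<^esub> y) a = act x a \<oplus>\<^bsub>V\<^esub> act y a"
    and act_add_right:
      "\<lbrakk>x \<in> carrier V; a \<in> carrier A; b \<in> carrier A\<rbrakk> \<Longrightarrow>
       act x (a \<oplus>\<^bsub>A\<^esub> b) = act x a \<oplus>\<^bsub>V\<^esub> act x b"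
    and act_smult_left:
      "\<lbrakk>c \<in> carrier K; x \<in> carrier V; a \<in> carrier A\<rbrakk> \<Longrightarrow>
       act (c \<odot>\<^bsub>V\<^esub> x) a = c \<odot>\<^bsub>V\<^esub> act x a"
    and act_smult_right:
      "\<lbrakk>c \<in> carrier K; x \<in> carrier V; a \<in> carrier A\<rbrakk> \<Longrightarrow>
       act x (c \<odot>\<^bsub>A\<^esub> a) = c \<odot>\<^bsub>V\<^esub> act x a"
    and act_bracket:
      "\<lbrakk>x \<in> carrier V; a \<in> carrier A; b \<in> carrier A\<rbrakk> \<Longrightarrow>
       act x (a \<otimes>\<^bsub>A\<^esub> b) = act (act x a) b \<ominus>\<^bsub>V\<^esub> act (act x b) a"
    and act_derivation:
      "\<lbrakk>x \<in> carrier V; y \<in> carrier V; a \<in> carrier A\<rbrakk> \<Longrightarrow>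
       act (x \<otimes>\<^bsub>V\<^esub> y) a = x \<otimes>\<^bsub>V\<^esub> act y a \<oplus>\<^bsub>V\<^esub> act x a \<otimes>\<^bsub>V\<^esub> y"

definition lie_semidirect ::
    "('k, 'a, 'm) module_scheme \<Rightarrow> ('k, 'b, 'n) module_scheme \<Rightarrow> ('b \<Rightarrow> 'a \<Rightarrow> 'b) \<Rightarrow>
     ('k, 'a \<times> 'b) module"
  where "lie_semidirect A V act =
    \<lparr>carrier = carrier A \<times> carrier V,
     monoid.mult = \<lambda>(a, x) (b, y).
       (a \<otimes>\<^bsub>A\<^esub> b, x \<otimes>\<^bsub>V\<^esub> y \<oplus>\<^bsub>V\<^esub> act x b \<ominus>\<^bsub>V\<^esub> act y a),
     one = (\<one>\<^bsub>A\<^esub>, \<one>\<^bsub>V\<^esub>),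
     ring.zero = (\<zero>\<^bsub>A\<^esub>, \<zero>\<^bsub>V\<^esub>),
     add = \<lambda>(a, x) (b, y). (a \<oplus>\<^bsub>A\<^esub> b, x \<oplus>\<^bsub>V\<^esub> y),
     smult = \<lambda>c (a, x). (c \<odot>\<^bsub>A\<^esub> a, c \<odot>\<^bsub>V\<^esub> x)\<rparr>"

lemma (in lie_algebra) bracket_neg_left:
  assumes "x \<in> carrier L" "y \<in> carrier L"
  shows "(\<ominus>\<^bsub>L\<^esub> x) \<otimes>\<^bsub>L\<^esub> y = \<ominus>\<^bsub>L\<^esub> (x \<otimes>\<^bsub>L\<^esub> y)"
proof -
  have e: "\<ominus>\<^bsub>L\<^esub> z = (\<ominus>\<^bsub>K\<^esub> \<one>\<^bsub>K\<^esub>) \<odot>\<^bsub>L\<^esub> z" if "z \<in> carrier L" for z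
    using that by (simp add: L.smult_l_minus)
  show ?thesis using assms by (simp add: e bracket_smult_left)
qed

lemma (in lie_algebra) bracket_neg_right:
  assumes "x \<in> carrier L" "y \<in> carrier L"
  shows "x \<otimes>\<^bsub>L\<^esub> (\<ominus>\<^bsub>L\<^esub> y) = \<ominus>\<^bsub>L\<^esub> (x \<otimes>\<^bsub>L\<^esub> y)"
proof -
  have e: "\<ominus>\<^bsub>L\<^esub> z = (\<ominus>\<^bsub>K\<^esub> \<one>\<^bsub>K\<^esub>) \<odot>\<^bsub>L\<^esub> z" if "z \<in> carrier L" for z
    using that by (simp add: L.smult_l_minus)
  show ?thesis using assms by (simp add: e bracket_smult_right)
qed

lemma (in lie_algebra) bracket_anticomm:
  assumes "x \<in> carrier L" "y \<in> carrier L"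
  shows "x \<otimes>\<^bsub>L\<^esub> y = \<ominus>\<^bsub>L\<^esub> (y \<otimes>\<^bsub>L\<^esub> x)"
proof -
  have "\<zero>\<^bsub>L\<^esub> = (x \<oplus>\<^bsub>L\<^esub> y) \<otimes>\<^bsub>L\<^esub> (x \<oplus>\<^bsub>L\<^esub> y)"
    using assms by (intro bracket_self[symmetric]) simp
  also have "\<dots> = x \<otimes>\<^bsub>L\<^esub> y \<oplus>\<^bsub>L\<^esub> y \<otimes>\<^bsub>L\<^esub> x"
    using assms by (simp add: bracket_add_left bracket_add_right L.M.a_ac del: bracket_self)
      (simp add: L.M.a_ac)
  finally have "x \<otimes>\<^bsub>L\<^esub> y \<oplus>\<^bsub>L\<^esub> y \<otimes>\<^bsub>L\<^esub> x = \<zero>\<^bsub>L\<^esub>" by simp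
  then show ?thesis using assms by (simp add: L.M.minus_equality)
qed

lemma (in lie_algebra) lie_subalgebra_imp_lie_algebra:
  assumes "lie_subalgebra K S L"
  shows "lie_algebra K (L\<lparr>carrier := S\<rparr>)"
proof -
  have sub: "submodule S K L" and cl: "\<And>x y. x \<in> S \<Longrightarrow> y \<in> S \<Longrightarrow> x \<otimes>\<^bsub>L\<^esub> y \<in> S"
    using assms by (auto simp: lie_subalgebra_def)
  have S: "\<And>x. x \<in> S \<Longrightarrow> x \<in> carrier L"
    using L.submoduleE(1)[OF sub] by blast
  interpret M: module K "L\<lparr>carrier := S\<rparr>"
    by (rule submodule.submodule_is_module[OF sub L.module_axioms])
  show ?thesis
    by unfold_locales
      (simp_all add: S cl bracket_add_left bracket_add_right bracket_smult_left
        bracket_smult_right jacobi)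
qed

lemma (in right_lie_action) lie_semidirect_lie_algebra:
  "lie_algebra K (lie_semidirect A V act)"
proof -
  let ?S = "lie_semidirect A V act"
  have act_neg: "act (\<ominus>\<^bsub>V\<^esub> x) a = \<ominus>\<^bsub>V\<^esub> act x a"
    if "x \<in> carrier V" "a \<in> carrier A" for x a
  proof -
    have e: "\<ominus>\<^bsub>V\<^esub> z = (\<ominus>\<^bsub>K\<^esub> \<one>\<^bsub>K\<^esub>) \<odot>\<^bsub>V\<^esub> z" if "z \<in> carrier V" for z
      using that by (simp add: V.L.smult_l_minus)
    show ?thesis using that by (simp add: e act_smult_left)
  qed
  have ab: "abelian_group ?S"
  proof (rule abelian_groupI)
    fix x assume x: "x \<in> carrier ?S"
    show "\<exists>y\<in>carrier ?S. y \<oplus>\<^bsub>?S\<^esub> x = \<zero>\<^bsub>?S\<^esub>"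
      using x by (intro bexI[of _ "(\<ominus>\<^bsub>A\<^esub> fst x, \<ominus>\<^bsub>V\<^esub> snd x)"])
        (auto simp: lie_semidirect_def A.L.M.l_neg V.L.M.l_neg)
  qed (auto simp: lie_semidirect_def A.L.M.a_ac V.L.M.a_ac)
  interpret S: module K ?S
    by (rule moduleI[OF A.K.cring_axioms ab])
      (auto simp: lie_semidirect_def A.L.smult_l_distr V.L.smult_l_distr A.L.smult_r_distr
        V.L.smult_r_distr A.L.smult_assoc1 V.L.smult_assoc1)
  show ?thesis
  proof unfold_locales
    fix p q r assume "p \<in> carrier ?S" "q \<in> carrier ?S" "r \<in> carrier ?S"
    then obtain a x b y c z where eq: "p = (a, x)" "q = (b, y)" "r = (c, z)"
      and mem: "a \<in> carrier A" "b \<in> carrier A" "c \<in> carrier A"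
        "x \<in> carrier V" "y \<in> carrier V" "z \<in> carrier V"
      by (auto simp: lie_semidirect_def)
    show "(p \<oplus>\<^bsub>?S\<^esub> q) \<otimes>\<^bsub>?S\<^esub> r = p \<otimes>\<^bsub>?S\<^esub> r \<oplus>\<^bsub>?S\<^esub> q \<otimes>\<^bsub>?S\<^esub> r"
      using mem by (simp add: eq lie_semidirect_def A.bracket_add_left V.bracket_add_left
        act_add_left act_add_right a_minus_def V.L.M.minus_add V.L.M.a_ac)
    show "p \<otimes>\<^bsub>?S\<^esub> (q \<oplus>\<^bsub>?S\<^esub> r) = p \<otimes>\<^bsub>?S\<^esub> q \<oplus>\<^bsub>?S\<^esub> p \<otimes>\<^bsub>?S\<^esub> r"
      using mem by (simp add: eq lie_semidirect_def A.bracket_add_right V.bracket_add_right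
        act_add_left act_add_right a_minus_def V.L.M.minus_add V.L.M.a_ac)
    define F where "F = (\<lambda>a x b y c z.
      (x \<otimes>\<^bsub>V\<^esub> act y c \<oplus>\<^bsub>V\<^esub> act (act x b) c) \<oplus>\<^bsub>V\<^esub> (z \<otimes>\<^bsub>V\<^esub> act y a \<oplus>\<^bsub>V\<^esub> act (act z b) a))"
    have F_closed: "F a x b y c z \<in> carrier V"
      if "a \<in> carrier A" "b \<in> carrier A" "c \<in> carrier A"
        "x \<in> carrier V" "y \<in> carrier V" "z \<in> carrier V" for a x b y c z
      using that by (simp add: F_def)
    have step: "(a, x) \<otimes>\<^bsub>?S\<^esub> ((b, y) \<otimes>\<^bsub>?S\<^esub> (c, z)) =
        (a \<otimes>\<^bsub>A\<^esub> (b \<otimes>\<^bsub>A\<^esub> c),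
         x \<otimes>\<^bsub>V\<^esub> (y \<otimes>\<^bsub>V\<^esub> z) \<oplus>\<^bsub>V\<^esub> (F a x b y c z \<oplus>\<^bsub>V\<^esub> \<ominus>\<^bsub>V\<^esub> F b y c z a x))"
      if m: "a \<in> carrier A" "b \<in> carrier A" "c \<in> carrier A"
        "x \<in> carrier V" "y \<in> carrier V" "z \<in> carrier V" for a x b y c z
    proof -
      have ac: "act y a \<otimes>\<^bsub>V\<^esub> z = \<ominus>\<^bsub>V\<^esub> (z \<otimes>\<^bsub>V\<^esub> act y a)"
        using m by (intro V.bracket_anticomm) auto
      show ?thesis
        using m by (simp add: lie_semidirect_def F_def V.bracket_add_right act_bracket
          act_derivation act_add_left act_neg V.bracket_neg_right ac a_minus_def
          V.L.M.minus_add V.L.M.a_ac)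
    qed
    have cancel: "(j1 \<oplus>\<^bsub>V\<^esub> (f \<oplus>\<^bsub>V\<^esub> \<ominus>\<^bsub>V\<^esub> g)) \<oplus>\<^bsub>V\<^esub> (j2 \<oplus>\<^bsub>V\<^esub> (g \<oplus>\<^bsub>V\<^esub> \<ominus>\<^bsub>V\<^esub> h)) \<oplus>\<^bsub>V\<^esub>
        (j3 \<oplus>\<^bsub>V\<^esub> (h \<oplus>\<^bsub>V\<^esub> \<ominus>\<^bsub>V\<^esub> f)) = j1 \<oplus>\<^bsub>V\<^esub> j2 \<oplus>\<^bsub>V\<^esub> j3"
      if m: "j1 \<in> carrier V" "j2 \<in> carrier V" "j3 \<in> carrier V"
        "f \<in> carrier V" "g \<in> carrier V" "h \<in> carrier V" for j1 j2 j3 f g h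
    proof -
      have "(j1 \<oplus>\<^bsub>V\<^esub> (f \<oplus>\<^bsub>V\<^esub> \<ominus>\<^bsub>V\<^esub> g)) \<oplus>\<^bsub>V\<^esub> (j2 \<oplus>\<^bsub>V\<^esub> (g \<oplus>\<^bsub>V\<^esub> \<ominus>\<^bsub>V\<^esub> h)) \<oplus>\<^bsub>V\<^esub>
          (j3 \<oplus>\<^bsub>V\<^esub> (h \<oplus>\<^bsub>V\<^esub> \<ominus>\<^bsub>V\<^esub> f)) =
          (j1 \<oplus>\<^bsub>V\<^esub> j2 \<oplus>\<^bsub>V\<^esub> j3) \<oplus>\<^bsub>V\<^esub> ((f \<oplus>\<^bsub>V\<^esub> \<ominus>\<^bsub>V\<^esub> f) \<oplus>\<^bsub>V\<^esub>
            ((g \<oplus>\<^bsub>V\<^esub> \<ominus>\<^bsub>V\<^esub> g) \<oplus>\<^bsub>V\<^esub> (h \<oplus>\<^bsub>V\<^esub> \<ominus>\<^bsub>V\<^esub> h)))"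
        using m by (simp only: V.L.M.a_ac V.L.M.a_closed V.L.M.a_inv_closed)
      then show ?thesis using m by (simp add: V.L.M.r_neg)
    qed
    show "p \<otimes>\<^bsub>?S\<^esub> (q \<otimes>\<^bsub>?S\<^esub> r) \<oplus>\<^bsub>?S\<^esub> q \<otimes>\<^bsub>?S\<^esub> (r \<otimes>\<^bsub>?S\<^esub> p) \<oplus>\<^bsub>?S\<^esub> r \<otimes>\<^bsub>?S\<^esub> (p \<otimes>\<^bsub>?S\<^esub> q) = \<zero>\<^bsub>?S\<^esub>"
      unfolding eq step[OF mem] step[OF mem(2,3,1,5,6,4)] step[OF mem(3,1,2,6,4,5)]
      using cancel[of "x \<otimes>\<^bsub>V\<^esub> (y \<otimes>\<^bsub>V\<^esub> z)" "y \<otimes>\<^bsub>V\<^esub> (z \<otimes>\<^bsub>V\<^esub> x)" "z \<otimes>\<^bsub>V\<^esub> (x \<otimes>\<^bsub>V\<^esub> y)"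
          "F a x b y c z" "F b y c z a x" "F c z a x b y"] mem F_closed
        A.jacobi[OF mem(1-3)] V.jacobi[OF mem(4-6)]
      by (simp add: lie_semidirect_def)
  next
    fix c p q assume "c \<in> carrier K" "p \<in> carrier ?S" "q \<in> carrier ?S"
    then show "(c \<odot>\<^bsub>?S\<^esub> p) \<otimes>\<^bsub>?S\<^esub> q = c \<odot>\<^bsub>?S\<^esub> (p \<otimes>\<^bsub>?S\<^esub> q)"
      and "p \<otimes>\<^bsub>?S\<^esub> (c \<odot>\<^bsub>?S\<^esub> q) = c \<odot>\<^bsub>?S\<^esub> (p \<otimes>\<^bsub>?S\<^esub> q)"
      by (auto simp: lie_semidirect_def A.bracket_smult_left V.bracket_smult_left
          A.bracket_smult_right V.bracket_smult_right act_smult_left act_smult_right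
          a_minus_def V.L.smult_r_distr V.L.smult_r_minus)
  qed (auto simp: lie_semidirect_def V.L.M.r_neg a_minus_def V.L.M.a_ac)
qed

end

theory Submission
  imports Defs
begin

text \<open>
  Put \<open>T = \<phi> \<gamma>\<close> and let \<open>N = 1 + T + \<dots> + T\<^sup>n\<^sup>-\<^sup>1\<close> be the norm. Then \<open>\<hh>\<^sup>G\<close> is the kernel and
  \<open>\<hh>\<^sub>\<gamma>\<close> the image of \<open>1 - T\<close>. The image of \<open>N\<close> is fixed by \<open>T\<close>, \<open>N\<close> vanishes on \<open>\<hh>\<^sub>\<gamma>\<close>,
  \<open>N\<close> is multiplication by \<open>n\<close> on \<open>\<hh>\<^sup>G\<close>, and \<open>n x - N x\<close> lies in \<open>\<hh>\<^sub>\<gamma>\<close> for every \<open>x\<close>; as \<open>n\<close> is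
  invertible, \<open>\<hh>\<close> is the direct sum of \<open>\<hh>\<^sup>G\<close> and \<open>\<hh>\<^sub>\<gamma>\<close>. For \<open>z, z' \<in> \<hh>\<^sub>\<gamma>\<close>, bracketing
  \<open>N z' = 0\<close> with \<open>z\<close> kills all terms but \<open>[z, z']\<close>, so \<open>\<hh>\<^sub>\<gamma>\<close> is in fact abelian.
\<close>

section \<open>Subtraction and integer multiples in abelian groups and modules\<close>

lemma (in abelian_group) minus_self: "a \<in> carrier G \<Longrightarrow> a \<ominus> a = \<zero>"
  by (simp add: a_minus_def r_neg)

lemma (in abelian_group) minus_add_minus:
  assumes "a \<in> carrier G" "b \<in> carrier G" "c \<in> carrier G" "d \<in> carrier G"
  shows "(a \<oplus> b) \<ominus> (c \<oplus> d) = (a \<ominus> c) \<oplus> (b \<ominus> d)"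
  using assms by (simp add: a_minus_def minus_add a_ac)

lemma (in abelian_group) minus_telescope:
  assumes "a \<in> carrier G" "b \<in> carrier G" "c \<in> carrier G"
  shows "(a \<ominus> b) \<oplus> (b \<ominus> c) = a \<ominus> c"
proof -
  have "(a \<ominus> b) \<oplus> (b \<ominus> c) = (a \<ominus> c) \<oplus> (b \<oplus> \<ominus> b)"
    using assms by (simp only: a_minus_def a_ac a_closed a_inv_closed)
  then show ?thesis using assms by (simp add: r_neg)
qed

lemma (in abelian_group) add_minus_self:
  assumes "a \<in> carrier G" "b \<in> carrier G"
  shows "a \<oplus> (b \<ominus> a) = b"
  using assms a_lcomm[of a b "\<ominus> a"] by (simp add: a_minus_def r_neg)

text \<open>Shrinking the carrier changes the definite description that defines negation, so this is
  not mere unfolding; uniqueness of additive inverses in \<open>M\<close> identifies the two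
  negatives.\<close>

lemma (in module) submodule_minus:
  assumes "submodule S R M" "x \<in> S" "y \<in> S"
  shows "x \<ominus>\<^bsub>M\<lparr>carrier := S\<rparr>\<^esub> y = x \<ominus>\<^bsub>M\<^esub> y"
proof -
  interpret S: module R "M\<lparr>carrier := S\<rparr>"
    by (rule submodule.submodule_is_module[OF assms(1) module_axioms])
  have "\<ominus>\<^bsub>M\<lparr>carrier := S\<rparr>\<^esub> y \<in> S" and sub: "S \<subseteq> carrier M"
    using S.M.a_inv_closed[of y] assms submoduleE(1) by auto
  then have "\<ominus>\<^bsub>M\<^esub> y = \<ominus>\<^bsub>M\<lparr>carrier := S\<rparr>\<^esub> y"
    using S.M.l_neg[of y] assms by (intro M.minus_equality) auto
  then show ?thesis by (simp add: a_minus_def)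
qed

text \<open>Closure under negation comes for free, as negation is scaling by -1.\<close>

lemma (in module) submoduleI_smult:
  assumes "S \<subseteq> carrier M" "\<zero>\<^bsub>M\<^esub> \<in> S" "\<And>x y. x \<in> S \<Longrightarrow> y \<in> S \<Longrightarrow> x \<oplus>\<^bsub>M\<^esub> y \<in> S"
    and smult: "\<And>c x. c \<in> carrier R \<Longrightarrow> x \<in> S \<Longrightarrow> c \<odot>\<^bsub>M\<^esub> x \<in> S"
  shows "submodule S R M"
proof (rule submoduleI)
  fix x assume x: "x \<in> S"
  have "\<ominus>\<^bsub>M\<^esub> x = (\<ominus> \<one>) \<odot>\<^bsub>M\<^esub> x"
    using x assms(1) by (simp add: smult_l_minus subset_iff)
  with x show "\<ominus>\<^bsub>M\<^esub> x \<in> S" by (simp add: smult)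
qed (use assms in auto)

text \<open>Puts scaling by an integer of the field into the recursive shape of
  \<open>orbit_sum\<close> below, so that both can be compared by induction on
  \<open>k\<close>.\<close>

lemma (in module) smult_add_pow_Suc:
  assumes "x \<in> carrier M"
  shows "([Suc k] \<cdot> \<one>) \<odot>\<^bsub>M\<^esub> x = ([k] \<cdot> \<one>) \<odot>\<^bsub>M\<^esub> x \<oplus>\<^bsub>M\<^esub> x"
  using assms by (simp add: smult_l_distr)

section \<open>Bracket identities and internal semidirect sums\<close>

context lie_algebra
begin

text \<open>Jacobi with \<open>z\<close> moved to the right by anticommutativity: bracketing by
  \<open>z\<close> on the right is a derivation.\<close>

lemma leibniz_right:
  assumes m: "x \<in> carrier L" "y \<in> carrier L" "z \<in> carrier L"
  shows "(x \<otimes>\<^bsub>L\<^esub> y) \<otimes>\<^bsub>L\<^esub> z = x \<otimes>\<^bsub>L\<^esub> (y \<otimes>\<^bsub>L\<^esub> z) \<oplus>\<^bsub>L\<^esub> (x \<otimes>\<^bsub>L\<^esub> z) \<otimes>\<^bsub>L\<^esub> y"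
proof -
  have 1: "z \<otimes>\<^bsub>L\<^esub> (x \<otimes>\<^bsub>L\<^esub> y) = \<ominus>\<^bsub>L\<^esub> ((x \<otimes>\<^bsub>L\<^esub> y) \<otimes>\<^bsub>L\<^esub> z)"
    using m by (intro bracket_anticomm) auto
  have "y \<otimes>\<^bsub>L\<^esub> (z \<otimes>\<^bsub>L\<^esub> x) = y \<otimes>\<^bsub>L\<^esub> (\<ominus>\<^bsub>L\<^esub> (x \<otimes>\<^bsub>L\<^esub> z))"
    using m bracket_anticomm[of z x] by simp
  also have "\<dots> = (x \<otimes>\<^bsub>L\<^esub> z) \<otimes>\<^bsub>L\<^esub> y"
    using m bracket_anticomm[of y "x \<otimes>\<^bsub>L\<^esub> z"] by (simp add: bracket_neg_right)
  finally have 2: "y \<otimes>\<^bsub>L\<^esub> (z \<otimes>\<^bsub>L\<^esub> x) = (x \<otimes>\<^bsub>L\<^esub> z) \<otimes>\<^bsub>L\<^esub> y" .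
  have "x \<otimes>\<^bsub>L\<^esub> (y \<otimes>\<^bsub>L\<^esub> z) \<oplus>\<^bsub>L\<^esub> (x \<otimes>\<^bsub>L\<^esub> z) \<otimes>\<^bsub>L\<^esub> y \<oplus>\<^bsub>L\<^esub> \<ominus>\<^bsub>L\<^esub> ((x \<otimes>\<^bsub>L\<^esub> y) \<otimes>\<^bsub>L\<^esub> z) = \<zero>\<^bsub>L\<^esub>"
    using jacobi[OF m] unfolding 1 2 .
  then show ?thesis
    using m by (metis L.M.minus_equality L.M.minus_minus L.M.a_closed L.M.a_inv_closed bracket_closed)
qed

text \<open>The Leibniz rule solved for one term; this is the compatibility of a right action with
  brackets.\<close>

lemma bracket_right_bracket:
  assumes "x \<in> carrier L" "y \<in> carrier L" "z \<in> carrier L"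
  shows "x \<otimes>\<^bsub>L\<^esub> (y \<otimes>\<^bsub>L\<^esub> z) = (x \<otimes>\<^bsub>L\<^esub> y) \<otimes>\<^bsub>L\<^esub> z \<ominus>\<^bsub>L\<^esub> (x \<otimes>\<^bsub>L\<^esub> z) \<otimes>\<^bsub>L\<^esub> y"
  using assms by (simp add: leibniz_right[of x y z] a_minus_def L.M.a_assoc L.M.r_neg)

lemma bracket_minus_left:
  assumes "x \<in> carrier L" "y \<in> carrier L" "z \<in> carrier L"
  shows "(x \<ominus>\<^bsub>L\<^esub> y) \<otimes>\<^bsub>L\<^esub> z = x \<otimes>\<^bsub>L\<^esub> z \<ominus>\<^bsub>L\<^esub> y \<otimes>\<^bsub>L\<^esub> z"
  using assms by (simp add: a_minus_def bracket_add_left bracket_neg_left)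

lemma bracket_zero_right [simp]:
  assumes "x \<in> carrier L"
  shows "x \<otimes>\<^bsub>L\<^esub> \<zero>\<^bsub>L\<^esub> = \<zero>\<^bsub>L\<^esub>"
proof -
  have "x \<otimes>\<^bsub>L\<^esub> \<zero>\<^bsub>L\<^esub> \<oplus>\<^bsub>L\<^esub> x \<otimes>\<^bsub>L\<^esub> \<zero>\<^bsub>L\<^esub> = x \<otimes>\<^bsub>L\<^esub> \<zero>\<^bsub>L\<^esub>"
    using assms bracket_add_right[of x "\<zero>\<^bsub>L\<^esub>" "\<zero>\<^bsub>L\<^esub>"] by simp
  then show ?thesis using assms by simp
qed

text \<open>The two axioms with content are the Leibniz rule and its rearrangement; the remaining
  ones are bilinearity and \<open>AV\<close>.\<close>

lemma bracket_action:
  assumes A: "lie_subalgebra K A L" and V: "lie_subalgebra K V L"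
    and AV: "\<And>x a. x \<in> V \<Longrightarrow> a \<in> A \<Longrightarrow> x \<otimes>\<^bsub>L\<^esub> a \<in> V"
  shows "right_lie_action K (L\<lparr>carrier := A\<rparr>) (L\<lparr>carrier := V\<rparr>) (\<lambda>x a. x \<otimes>\<^bsub>L\<^esub> a)"
proof -
  interpret A: lie_algebra K "L\<lparr>carrier := A\<rparr>" by (rule lie_subalgebra_imp_lie_algebra[OF A])
  interpret V: lie_algebra K "L\<lparr>carrier := V\<rparr>" by (rule lie_subalgebra_imp_lie_algebra[OF V])
  have sub: "A \<subseteq> carrier L" "V \<subseteq> carrier L" and sm: "submodule V K L"
    using A V L.submoduleE(1) by (auto simp: lie_subalgebra_def)
  show ?thesis
  proof unfold_locales
    fix x a b
    assume "x \<in> carrier (L\<lparr>carrier := V\<rparr>)"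
      "a \<in> carrier (L\<lparr>carrier := A\<rparr>)" "b \<in> carrier (L\<lparr>carrier := A\<rparr>)"
    then show "x \<otimes>\<^bsub>L\<^esub> (a \<otimes>\<^bsub>L\<lparr>carrier := A\<rparr>\<^esub> b) =
        (x \<otimes>\<^bsub>L\<^esub> a) \<otimes>\<^bsub>L\<^esub> b \<ominus>\<^bsub>L\<lparr>carrier := V\<rparr>\<^esub> (x \<otimes>\<^bsub>L\<^esub> b) \<otimes>\<^bsub>L\<^esub> a"
      using sub by (simp add: AV subset_iff L.submodule_minus[OF sm] bracket_right_bracket)
  next
    fix x y a
    assume "x \<in> carrier (L\<lparr>carrier := V\<rparr>)" "y \<in> carrier (L\<lparr>carrier := V\<rparr>)"
      "a \<in> carrier (L\<lparr>carrier := A\<rparr>)"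
    then show "(x \<otimes>\<^bsub>L\<lparr>carrier := V\<rparr>\<^esub> y) \<otimes>\<^bsub>L\<^esub> a =
        x \<otimes>\<^bsub>L\<lparr>carrier := V\<rparr>\<^esub> (y \<otimes>\<^bsub>L\<^esub> a)
          \<oplus>\<^bsub>L\<lparr>carrier := V\<rparr>\<^esub> (x \<otimes>\<^bsub>L\<^esub> a) \<otimes>\<^bsub>L\<lparr>carrier := V\<rparr>\<^esub> y"
      using sub leibniz_right[of x y a] by (simp add: subset_iff)
  qed (use sub in \<open>simp_all add: AV subset_iff bracket_add_left bracket_add_right
      bracket_smult_left bracket_smult_right\<close>)
qed

text \<open>The semidirect bracket is what bilinear expansion of a bracket of two sums produces,
  once [a, y] is written as -[y, a]; directness of the sum then gives bijectivity.\<close>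

lemma lie_semidirect_sum_iso:
  assumes A: "lie_subalgebra K A L" and V: "lie_subalgebra K V L"
    and AV: "\<And>x a. x \<in> V \<Longrightarrow> a \<in> A \<Longrightarrow> x \<otimes>\<^bsub>L\<^esub> a \<in> V"
    and disj: "A \<inter> V \<subseteq> {\<zero>\<^bsub>L\<^esub>}"
    and span: "\<And>x. x \<in> carrier L \<Longrightarrow> \<exists>a\<in>A. \<exists>v\<in>V. x = a \<oplus>\<^bsub>L\<^esub> v"
  shows "(\<lambda>(a, x). a \<oplus>\<^bsub>L\<^esub> x) \<in>
    lie_iso K (lie_semidirect (L\<lparr>carrier := A\<rparr>) (L\<lparr>carrier := V\<rparr>) (\<lambda>x a. x \<otimes>\<^bsub>L\<^esub> a)) L"
proof -
  have smA: "submodule A K L" and smV: "submodule V K L"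
    and V_br: "\<And>x y. x \<in> V \<Longrightarrow> y \<in> V \<Longrightarrow> x \<otimes>\<^bsub>L\<^esub> y \<in> V"
    using A V by (auto simp: lie_subalgebra_def)
  have Ac: "\<And>a. a \<in> A \<Longrightarrow> a \<in> carrier L" and Vc: "\<And>v. v \<in> V \<Longrightarrow> v \<in> carrier L"
    using L.submoduleE(1)[OF smA] L.submoduleE(1)[OF smV] by auto
  \<comment> \<open>The subtraction on the right is the one of the restricted record, since that is
    the one \<open>lie_semidirect\<close> uses.\<close>
  have bracket: "(a \<oplus>\<^bsub>L\<^esub> x) \<otimes>\<^bsub>L\<^esub> (b \<oplus>\<^bsub>L\<^esub> y) = a \<otimes>\<^bsub>L\<^esub> b \<oplus>\<^bsub>L\<^esub>
      (x \<otimes>\<^bsub>L\<^esub> y \<oplus>\<^bsub>L\<^esub> x \<otimes>\<^bsub>L\<^esub> b \<ominus>\<^bsub>L\<lparr>carrier := V\<rparr>\<^esub> y \<otimes>\<^bsub>L\<^esub> a)"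
    if m: "a \<in> A" "b \<in> A" "x \<in> V" "y \<in> V" for a b x y
  proof -
    have "x \<otimes>\<^bsub>L\<^esub> y \<oplus>\<^bsub>L\<^esub> x \<otimes>\<^bsub>L\<^esub> b \<ominus>\<^bsub>L\<lparr>carrier := V\<rparr>\<^esub> y \<otimes>\<^bsub>L\<^esub> a =
        x \<otimes>\<^bsub>L\<^esub> y \<oplus>\<^bsub>L\<^esub> x \<otimes>\<^bsub>L\<^esub> b \<ominus>\<^bsub>L\<^esub> y \<otimes>\<^bsub>L\<^esub> a"
      using m by (intro L.submodule_minus[OF smV] L.submoduleE(5)[OF smV] V_br AV)
    moreover have "a \<otimes>\<^bsub>L\<^esub> y = \<ominus>\<^bsub>L\<^esub> (y \<otimes>\<^bsub>L\<^esub> a)"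
      using m by (intro bracket_anticomm Ac Vc)
    ultimately show ?thesis
      using m by (simp add: Ac Vc bracket_add_left
          bracket_add_right a_minus_def L.M.a_ac)
  qed
  \<comment> \<open>Equal sums a + x = b + y give a - b = -(x - y), an element of both
    \<open>A\<close> and \<open>V\<close>, hence zero.\<close>
  have "inj_on (\<lambda>(a, x). a \<oplus>\<^bsub>L\<^esub> x) (A \<times> V)"
  proof (rule inj_onI, clarify)
    fix a x b y
    assume m: "a \<in> A" "x \<in> V" "b \<in> A" "y \<in> V" and eq: "a \<oplus>\<^bsub>L\<^esub> x = b \<oplus>\<^bsub>L\<^esub> y"
    have "(a \<ominus>\<^bsub>L\<^esub> b) \<oplus>\<^bsub>L\<^esub> (x \<ominus>\<^bsub>L\<^esub> y) = \<zero>\<^bsub>L\<^esub>"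
      using m eq L.M.minus_add_minus[of a x b y] by (simp add: Ac Vc L.M.minus_self)
    then have "a \<ominus>\<^bsub>L\<^esub> b = \<ominus>\<^bsub>L\<^esub> (x \<ominus>\<^bsub>L\<^esub> y)"
      using m by (simp add: Ac Vc L.M.minus_equality)
    moreover have "a \<ominus>\<^bsub>L\<^esub> b \<in> A" "\<ominus>\<^bsub>L\<^esub> (x \<ominus>\<^bsub>L\<^esub> y) \<in> V"
      using m by (simp_all add: a_minus_def L.submoduleE[OF smA] L.submoduleE[OF smV])
    ultimately have "a \<ominus>\<^bsub>L\<^esub> b = \<zero>\<^bsub>L\<^esub>" using disj by auto
    then have "a = b"
      using m L.M.add_minus_self[of b a] by (simp add: Ac)
    with eq show "a = b \<and> x = y" using m by (simp add: Ac Vc)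
  qed
  moreover have "(\<lambda>(a, x). a \<oplus>\<^bsub>L\<^esub> x) ` (A \<times> V) = carrier L"
    using span by (fastforce simp: Ac Vc)
  ultimately show ?thesis
    by (auto simp: lie_iso_def lie_hom_def lie_semidirect_def bij_betw_def Ac Vc bracket
        L.smult_r_distr L.M.a_ac)
qed

end

section \<open>Fixed points, differences and the norm of a periodic Lie endomorphism\<close>

text \<open>Reduces the cyclic group action to the single operator by which the generator acts, so
  that the norm argument involves iterates of \<open>T\<close> only.\<close>

locale periodic_lie_endomorphism = lie_algebra K L for K (structure) and L (structure) +
  fixes T :: "'c \<Rightarrow> 'c" and n :: nat
  assumes hom: "T \<in> lie_hom K L L"
    and periodic: "x \<in> carrier L \<Longrightarrow> (T ^^ n) x = x"
    and unit: "[n] \<cdot>\<^bsub>K\<^esub> \<one>\<^bsub>K\<^esub> \<in> Units K"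
begin

definition fixed where "fixed = {x \<in> carrier L. T x = x}"

definition differences where "differences = {y \<ominus>\<^bsub>L\<^esub> T y | y. y \<in> carrier L}"

text \<open>Partial sums of the norm: N is \<open>orbit_sum n\<close>, and a general length makes
  the identities below provable by induction.\<close>

primrec orbit_sum where
  "orbit_sum 0 x = \<zero>\<^bsub>L\<^esub>"
| "orbit_sum (Suc k) x = orbit_sum k x \<oplus>\<^bsub>L\<^esub> (T ^^ k) x"

lemma T_closed [simp]: "x \<in> carrier L \<Longrightarrow> T x \<in> carrier L"
  and T_add: "\<lbrakk>x \<in> carrier L; y \<in> carrier L\<rbrakk> \<Longrightarrow> T (x \<oplus>\<^bsub>L\<^esub> y) = T x \<oplus>\<^bsub>L\<^esub> T y"
  and T_smult: "\<lbrakk>c \<in> carrier K; x \<in> carrier L\<rbrakk> \<Longrightarrow> T (c \<odot>\<^bsub>L\<^esub> x) = c \<odot>\<^bsub>L\<^esub> T x"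
  and T_bracket: "\<lbrakk>x \<in> carrier L; y \<in> carrier L\<rbrakk> \<Longrightarrow> T (x \<otimes>\<^bsub>L\<^esub> y) = T x \<otimes>\<^bsub>L\<^esub> T y"
  using hom by (auto simp: lie_hom_def)

lemma T_zero [simp]: "T \<zero>\<^bsub>L\<^esub> = \<zero>\<^bsub>L\<^esub>"
  using T_smult[of "\<zero>\<^bsub>K\<^esub>" "\<zero>\<^bsub>L\<^esub>"] by simp

lemma T_pow_closed [simp]: "x \<in> carrier L \<Longrightarrow> (T ^^ k) x \<in> carrier L"
  by (induction k) auto

lemma orbit_sum_closed [simp]: "x \<in> carrier L \<Longrightarrow> orbit_sum k x \<in> carrier L"
  by (induction k) auto

lemma fixedI: "\<lbrakk>x \<in> carrier L; T x = x\<rbrakk> \<Longrightarrow> x \<in> fixed"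
  by (simp add: fixed_def)

lemma fixed_subset: "x \<in> fixed \<Longrightarrow> x \<in> carrier L"
  by (simp add: fixed_def)

lemma differences_subset: "x \<in> differences \<Longrightarrow> x \<in> carrier L"
  by (auto simp: differences_def)

lemma differences_zero: "\<zero>\<^bsub>L\<^esub> \<in> differences"
  unfolding differences_def by (rule CollectI, rule exI[of _ "\<zero>\<^bsub>L\<^esub>"]) (simp add: L.M.minus_self)

lemma differences_add:
  assumes "x \<in> differences" "y \<in> differences"
  shows "x \<oplus>\<^bsub>L\<^esub> y \<in> differences"
proof -
  obtain a b where "a \<in> carrier L" "b \<in> carrier L" "x = a \<ominus>\<^bsub>L\<^esub> T a" "y = b \<ominus>\<^bsub>L\<^esub> T b"
    using assms by (auto simp: differences_def)
  then show ?thesis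
    by (auto simp: differences_def T_add L.M.minus_add_minus intro!: exI[of _ "a \<oplus>\<^bsub>L\<^esub> b"])
qed

lemma differences_smult:
  assumes "c \<in> carrier K" "x \<in> differences"
  shows "c \<odot>\<^bsub>L\<^esub> x \<in> differences"
proof -
  obtain a where "a \<in> carrier L" "x = a \<ominus>\<^bsub>L\<^esub> T a"
    using assms by (auto simp: differences_def)
  then show ?thesis using assms
    by (auto simp: differences_def T_smult a_minus_def L.smult_r_distr L.smult_r_minus
        intro!: exI[of _ "c \<odot>\<^bsub>L\<^esub> a"])
qed

text \<open>For fixed \<open>a\<close>, bracketing with \<open>a\<close> commutes with
  \<open>T\<close>, so it carries the difference of \<open>y\<close> to the difference of
  [y, a].\<close>

lemma differences_bracket_fixed:
  assumes "x \<in> differences" "a \<in> fixed"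
  shows "x \<otimes>\<^bsub>L\<^esub> a \<in> differences"
proof -
  obtain y where y: "y \<in> carrier L" "x = y \<ominus>\<^bsub>L\<^esub> T y"
    using assms by (auto simp: differences_def)
  then have "x \<otimes>\<^bsub>L\<^esub> a = y \<otimes>\<^bsub>L\<^esub> a \<ominus>\<^bsub>L\<^esub> T (y \<otimes>\<^bsub>L\<^esub> a)"
    using assms by (simp add: fixed_def T_bracket bracket_minus_left)
  with y show ?thesis using fixed_subset[OF assms(2)] by (auto simp: differences_def)
qed

lemma fixed_lie_subalgebra: "lie_subalgebra K fixed L"
  unfolding lie_subalgebra_def
  by (auto intro!: L.submoduleI_smult simp: fixed_def T_add T_smult T_bracket)

lemma differences_submodule: "submodule differences K L"
  by (auto intro!: L.submoduleI_smult differences_subset differences_zero differences_add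
      differences_smult)

text \<open>Both sides are the orbit sum of length k + 1, split off at its first or at its last
  term.\<close>

lemma T_orbit_sum:
  assumes "x \<in> carrier L"
  shows "x \<oplus>\<^bsub>L\<^esub> T (orbit_sum k x) = orbit_sum k x \<oplus>\<^bsub>L\<^esub> (T ^^ k) x"
proof (induction k)
  case (Suc k)
  have "x \<oplus>\<^bsub>L\<^esub> T (orbit_sum (Suc k) x) = (x \<oplus>\<^bsub>L\<^esub> T (orbit_sum k x)) \<oplus>\<^bsub>L\<^esub> T ((T ^^ k) x)"
    using assms by (simp add: T_add L.M.a_assoc)
  then show ?case unfolding Suc by simp
qed (use assms in simp)

text \<open>At length \<open>n\<close> the last term of the shifted sum returns to \<open>x\<close>,
  which cancels against the first.\<close>

lemma norm_fixed:
  assumes "x \<in> carrier L"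
  shows "orbit_sum n x \<in> fixed"
proof (rule fixedI)
  have "x \<oplus>\<^bsub>L\<^esub> T (orbit_sum n x) = x \<oplus>\<^bsub>L\<^esub> orbit_sum n x"
    using assms T_orbit_sum[of x n] by (simp add: periodic L.M.a_comm)
  then show "T (orbit_sum n x) = orbit_sum n x" using assms by simp
qed (use assms in simp)

lemma T_pow_difference:
  assumes "y \<in> carrier L"
  shows "(T ^^ k) (y \<ominus>\<^bsub>L\<^esub> T y) = (T ^^ k) y \<ominus>\<^bsub>L\<^esub> (T ^^ Suc k) y"
proof (induction k)
  case (Suc k)
  \<comment> \<open>Only additivity of \<open>T\<close> is at hand, so \<open>a\<close> is written
    as b + (a - b) and \<open>T b\<close> is cancelled.\<close>
  have "T (a \<ominus>\<^bsub>L\<^esub> b) = T a \<ominus>\<^bsub>L\<^esub> T b" if "a \<in> carrier L" "b \<in> carrier L" for a b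
  proof -
    have "T a = T (b \<oplus>\<^bsub>L\<^esub> (a \<ominus>\<^bsub>L\<^esub> b))" using that by (simp add: L.M.add_minus_self)
    also have "\<dots> = T b \<oplus>\<^bsub>L\<^esub> T (a \<ominus>\<^bsub>L\<^esub> b)" using that by (simp add: T_add)
    finally show ?thesis
      using that by (metis L.M.add_minus_self L.M.add.l_cancel L.M.minus_closed T_closed)
  qed
  with Suc show ?case using assms by simp
qed simp

lemma norm_differences:
  assumes "x \<in> differences"
  shows "orbit_sum n x = \<zero>\<^bsub>L\<^esub>"
proof -
  obtain y where y: "y \<in> carrier L" "x = y \<ominus>\<^bsub>L\<^esub> T y"
    using assms by (auto simp: differences_def)
  \<comment> \<open>The sum telescopes at every length; periodicity enters only afterwards, at
    length \<open>n\<close>.\<close>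
  have "orbit_sum k x = y \<ominus>\<^bsub>L\<^esub> (T ^^ k) y" for k
  proof (induction k)
    case (Suc k)
    then show ?case
      using y by (simp add: T_pow_difference L.M.minus_telescope del: funpow.simps)
  qed (use y in \<open>simp add: L.M.minus_self\<close>)
  then show ?thesis using y by (simp add: periodic L.M.minus_self)
qed

lemma norm_on_fixed:
  assumes "x \<in> fixed"
  shows "orbit_sum k x = ([k] \<cdot>\<^bsub>K\<^esub> \<one>\<^bsub>K\<^esub>) \<odot>\<^bsub>L\<^esub> x"
proof (induction k)
  case (Suc k)
  have "(T ^^ k) x = x" using assms by (induction k) (auto simp: fixed_def)
  with Suc show ?case
    using fixed_subset[OF assms] by (simp add: L.smult_add_pow_Suc del: K.add.nat_pow_Suc)
qed (use fixed_subset[OF assms] in simp)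

text \<open>The element is the sum of all x - T^i x with i < k, and each summand is a
  difference.\<close>

lemma smult_minus_orbit_sum:
  assumes x: "x \<in> carrier L"
  shows "([k] \<cdot>\<^bsub>K\<^esub> \<one>\<^bsub>K\<^esub>) \<odot>\<^bsub>L\<^esub> x \<ominus>\<^bsub>L\<^esub> orbit_sum k x \<in> differences"
proof (induction k)
  case 0
  then show ?case using x differences_zero by (simp add: L.M.minus_self)
next
  case (Suc k)
  \<comment> \<open>Telescoping again: x - T^k x is the sum over i < k of T^i x - T^(i+1) x, which
    is the difference of T^i x.\<close>
  have "x \<ominus>\<^bsub>L\<^esub> (T ^^ k) x \<in> differences"
  proof (induction k)
    case 0
    then show ?case using x differences_zero by (simp add: L.M.minus_self)
  next
    case (Suc k)
    have "(T ^^ k) x \<ominus>\<^bsub>L\<^esub> (T ^^ Suc k) x \<in> differences"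
      using x by (auto simp: differences_def)
    from differences_add[OF Suc this] show ?case
      using x by (simp add: L.M.minus_telescope)
  qed
  with Suc have "(([k] \<cdot>\<^bsub>K\<^esub> \<one>\<^bsub>K\<^esub>) \<odot>\<^bsub>L\<^esub> x \<ominus>\<^bsub>L\<^esub> orbit_sum k x) \<oplus>\<^bsub>L\<^esub> (x \<ominus>\<^bsub>L\<^esub> (T ^^ k) x) \<in> differences"
    by (rule differences_add)
  then show ?case
    using x by (simp add: L.smult_add_pow_Suc L.M.minus_add_minus del: K.add.nat_pow_Suc)
qed

lemma smult_inv_smult:
  assumes "x \<in> carrier L"
  shows "inv\<^bsub>K\<^esub> ([n] \<cdot>\<^bsub>K\<^esub> \<one>\<^bsub>K\<^esub>) \<odot>\<^bsub>L\<^esub> (([n] \<cdot>\<^bsub>K\<^esub> \<one>\<^bsub>K\<^esub>) \<odot>\<^bsub>L\<^esub> x) = x"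
  using assms unit by (simp add: K.Units_l_inv flip: L.smult_assoc1)

text \<open>On the intersection the norm is both multiplication by \<open>n\<close> and
  zero.\<close>

lemma fixed_inter_differences: "fixed \<inter> differences \<subseteq> {\<zero>\<^bsub>L\<^esub>}"
proof clarify
  fix x assume x: "x \<in> fixed" "x \<in> differences"
  then have "([n] \<cdot>\<^bsub>K\<^esub> \<one>\<^bsub>K\<^esub>) \<odot>\<^bsub>L\<^esub> x = \<zero>\<^bsub>L\<^esub>"
    using norm_on_fixed[of x n] norm_differences[of x] by simp
  then show "x = \<zero>\<^bsub>L\<^esub>"
    using smult_inv_smult[of x] x unit fixed_subset by simp
qed

text \<open>Divide n x = N x + (n x - N x) by \<open>n\<close>.\<close>

lemma fixed_plus_differences:
  assumes x: "x \<in> carrier L"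
  shows "\<exists>a\<in>fixed. \<exists>v\<in>differences. x = a \<oplus>\<^bsub>L\<^esub> v"
proof -
  let ?n = "[n] \<cdot>\<^bsub>K\<^esub> \<one>\<^bsub>K\<^esub>"
  let ?d = "?n \<odot>\<^bsub>L\<^esub> x \<ominus>\<^bsub>L\<^esub> orbit_sum n x"
  have "inv\<^bsub>K\<^esub> ?n \<odot>\<^bsub>L\<^esub> orbit_sum n x \<in> fixed"
    using fixed_lie_subalgebra norm_fixed[OF x] unit
    by (auto simp: lie_subalgebra_def intro: L.submoduleE(4))
  moreover have "inv\<^bsub>K\<^esub> ?n \<odot>\<^bsub>L\<^esub> ?d \<in> differences"
    using smult_minus_orbit_sum[OF x, of n] unit by (intro differences_smult) auto
  moreover have "x = inv\<^bsub>K\<^esub> ?n \<odot>\<^bsub>L\<^esub> orbit_sum n x \<oplus>\<^bsub>L\<^esub> inv\<^bsub>K\<^esub> ?n \<odot>\<^bsub>L\<^esub> ?d"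
    using x unit by (simp add: L.M.add_minus_self smult_inv_smult flip: L.smult_r_distr)
  ultimately show ?thesis by blast
qed

text \<open>Expand [z, N z'] = 0: by \<open>ab\<close> only the term of index 0 survives.\<close>

lemma differences_abelian:
  assumes ab: "\<And>i z z'. \<lbrakk>0 < i; i < n; z \<in> differences; z' \<in> differences\<rbrakk> \<Longrightarrow>
      z \<otimes>\<^bsub>L\<^esub> (T ^^ i) z' = \<zero>\<^bsub>L\<^esub>"
    and z: "z \<in> differences" "z' \<in> differences"
  shows "z \<otimes>\<^bsub>L\<^esub> z' = \<zero>\<^bsub>L\<^esub>"
proof -
  have c: "z \<in> carrier L" "z' \<in> carrier L" using z differences_subset by auto
  \<comment> \<open>The induction starts at length 1, because the term of index 0 is the one to
    keep; k < n keeps all later indices within the range of \<open>ab\<close>.\<close>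
  have "z \<otimes>\<^bsub>L\<^esub> orbit_sum (Suc k) z' = z \<otimes>\<^bsub>L\<^esub> z'" if "k < n" for k
    using that
  proof (induction k)
    case (Suc k)
    then have "z \<otimes>\<^bsub>L\<^esub> orbit_sum (Suc k) z' = z \<otimes>\<^bsub>L\<^esub> z'" by simp
    moreover have "z \<otimes>\<^bsub>L\<^esub> (T ^^ Suc k) z' = \<zero>\<^bsub>L\<^esub>" using Suc z by (intro ab) auto
    moreover have "z \<otimes>\<^bsub>L\<^esub> orbit_sum (Suc (Suc k)) z' =
        z \<otimes>\<^bsub>L\<^esub> orbit_sum (Suc k) z' \<oplus>\<^bsub>L\<^esub> z \<otimes>\<^bsub>L\<^esub> (T ^^ Suc k) z'"
      unfolding orbit_sum.simps(2)[of "Suc k"] using c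
      by (intro bracket_add_right orbit_sum_closed T_pow_closed)
    ultimately show ?case using c by simp
  qed (use c in simp)
  \<comment> \<open>For \<open>n\<close> = 0 the unit would be zero, impossible in a field. Hence
    \<open>n\<close> is a successor and the claim above applies with k = n - 1.\<close>
  moreover have "n \<noteq> 0"
    using unit by (metis K.Units_r_inv_ex K.add.nat_pow_0 K.l_null K.one_not_zero)
  ultimately have "z \<otimes>\<^bsub>L\<^esub> orbit_sum n z' = z \<otimes>\<^bsub>L\<^esub> z'"
    by (metis Suc_pred lessI not_gr_zero)
  then show ?thesis using norm_differences[OF z(2)] c by simp
qed

end

section \<open>Actions by Lie automorphisms, evaluated pointwise\<close>

text \<open>Multiplication of automorphisms is composition restricted to the carrier, so it can be
  evaluated only at points of \<open>L\<close>.\<close>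

lemma hom_LieAutGroup_apply:
  assumes "\<phi> \<in> hom G (LieAutGroup K L)" "g \<in> carrier G" "h \<in> carrier G" "x \<in> carrier L"
  shows "\<phi> (g \<otimes>\<^bsub>G\<^esub> h) x = \<phi> g (\<phi> h x)"
  using assms by (auto simp: hom_def LieAutGroup_def BijGroup_def compose_def Pi_iff)

lemma hom_LieAutGroup_lie_hom:
  assumes "\<phi> \<in> hom G (LieAutGroup K L)" "g \<in> carrier G"
  shows "\<phi> g \<in> lie_hom K L L" and "bij_betw (\<phi> g) (carrier L) (carrier L)"
  using assms by (auto simp: hom_def LieAutGroup_def Bij_def Pi_iff)

text \<open>\<open>hom\<close> records multiplicativity alone. It makes the image of the unit
  idempotent, and an idempotent injective map is the identity.\<close>

lemma hom_LieAutGroup_one: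
  assumes "group G" "\<phi> \<in> hom G (LieAutGroup K L)" "x \<in> carrier L"
  shows "\<phi> \<one>\<^bsub>G\<^esub> x = x"
proof -
  interpret group G by fact
  have bij: "bij_betw (\<phi> \<one>\<^bsub>G\<^esub>) (carrier L) (carrier L)"
    using assms by (simp add: hom_LieAutGroup_lie_hom(2))
  moreover have "\<phi> \<one>\<^bsub>G\<^esub> (\<phi> \<one>\<^bsub>G\<^esub> x) = \<phi> \<one>\<^bsub>G\<^esub> x"
    using assms hom_LieAutGroup_apply[of \<phi> G K L "\<one>\<^bsub>G\<^esub>" "\<one>\<^bsub>G\<^esub>" x] by simp
  ultimately show ?thesis
    using assms(3) by (meson bij_betw_apply bij_betw_imp_inj_on inj_onD)
qed

lemma hom_LieAutGroup_pow:
  assumes "group G" "\<phi> \<in> hom G (LieAutGroup K L)" "g \<in> carrier G" "x \<in> carrier L"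
  shows "\<phi> (g [^]\<^bsub>G\<^esub> (k::nat)) x = (\<phi> g ^^ k) x"
proof -
  interpret group G by fact
  show ?thesis using assms(4)
  \<comment> \<open>The successor power multiplies by \<open>g\<close> on the right, so
    \<open>g\<close> acts first and the induction hypothesis is used at the point \<phi> g
    x.\<close>
  proof (induction k arbitrary: x)
    case 0
    then show ?case using assms by (simp add: hom_LieAutGroup_one)
  next
    case (Suc k)
    then have "\<phi> g x \<in> carrier L"
      using bij_betw_apply[OF hom_LieAutGroup_lie_hom(2)[OF assms(2,3)]] by simp
    then show ?case
      using Suc assms by (simp add: hom_LieAutGroup_apply[OF assms(2)] funpow_swap1)
  qed
qed

section \<open>The cyclic group case, with \<phi> \<gamma> as the periodic endomorphism\<close>

theorem corollary3p14:
  fixes K :: "('k, 'r) ring_scheme"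
    and \<hh> :: "('k, 'a, 'm) module_scheme"
    and G :: "('g, 'p) monoid_scheme"
    and \<gamma> :: 'g
    and n :: nat
    and \<phi> :: "'g \<Rightarrow> 'a \<Rightarrow> 'a"
  assumes "field K"
    and "lie_algebra K \<hh>"
    and "group G" and "finite (carrier G)"
    and "\<gamma> \<in> carrier G" and "generate G {\<gamma>} = carrier G"
    and "n = group.ord G \<gamma>"
    and "[n] \<cdot>\<^bsub>K\<^esub> \<one>\<^bsub>K\<^esub> \<in> Units K"
    and "\<phi> \<in> hom G (LieAutGroup K \<hh>)"
    and "gamma_abelian G \<hh> \<phi> \<gamma>"
  shows "lie_subalgebra K (lie_invariants G \<hh> \<phi>) \<hh> \<and>
    lie_subalgebra K (gamma_differences \<hh> \<phi> \<gamma>) \<hh> \<and>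
    right_lie_action K
      (\<hh>\<lparr>carrier := lie_invariants G \<hh> \<phi>\<rparr>) (\<hh>\<lparr>carrier := gamma_differences \<hh> \<phi> \<gamma>\<rparr>)
      (\<lambda>x g. x \<otimes>\<^bsub>\<hh>\<^esub> g) \<and>
    (\<lambda>(g, x). g \<oplus>\<^bsub>\<hh>\<^esub> x) \<in> lie_iso K
      (lie_semidirect
        (\<hh>\<lparr>carrier := lie_invariants G \<hh> \<phi>\<rparr>) (\<hh>\<lparr>carrier := gamma_differences \<hh> \<phi> \<gamma>\<rparr>)
        (\<lambda>x g. x \<otimes>\<^bsub>\<hh>\<^esub> g))
      \<hh>"
proof -
  interpret G: group G by fact
  interpret lie_algebra K \<hh> by fact
  note pow = hom_LieAutGroup_pow[OF assms(3,9,5)]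
  interpret periodic_lie_endomorphism K \<hh> "\<phi> \<gamma>" n
  proof
    show "\<phi> \<gamma> \<in> lie_hom K \<hh> \<hh>" using assms by (simp add: hom_LieAutGroup_lie_hom)
    \<comment> \<open>The n-th iterate is the action of the n-th power of \<gamma>, which is the
      unit as \<open>n\<close> is the order.\<close>
    show "(\<phi> \<gamma> ^^ n) x = x" if "x \<in> carrier \<hh>" for x
      using pow[OF that, of n] that assms by (simp add: hom_LieAutGroup_one)
  qed fact
  have diff: "gamma_differences \<hh> \<phi> \<gamma> = differences"
    by (simp add: gamma_differences_def differences_def)
  \<comment> \<open>In a finite group natural powers of the generator already exhaust it, so
    invariance under G means being fixed by \<phi> \<gamma>.\<close>
  have "carrier G = {\<gamma> [^]\<^bsub>G\<^esub> k | k. k \<in> (UNIV :: nat set)}"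
    using G.generate_pow_on_finite_carrier[OF assms(4,5)] assms(6) by simp
  moreover have "(\<phi> \<gamma> ^^ k) x = x" if "x \<in> fixed" for x k
    using that by (induction k) (auto simp: fixed_def)
  ultimately have inv: "lie_invariants G \<hh> \<phi> = fixed"
    using assms(5) by (auto simp: lie_invariants_def fixed_def pow)
  have abelian: "z \<otimes>\<^bsub>\<hh>\<^esub> z' = \<zero>\<^bsub>\<hh>\<^esub>" if "z \<in> differences" "z' \<in> differences" for z z'
  proof (rule differences_abelian[OF _ that])
    fix i z z' assume i: "0 < i" "i < n" and z: "z \<in> differences" "z' \<in> differences"
    \<comment> \<open>An exponent strictly between 0 and the order gives a power other than the
      unit; the \<gamma>-abelian condition is then used for the pair of the unit and this
      power.\<close>
    have "\<one>\<^bsub>G\<^esub> \<noteq> \<gamma> [^]\<^bsub>G\<^esub> i"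
      using i assms(5,7) by (metis G.pow_eq_id nat_dvd_not_less)
    then have "\<phi> \<one>\<^bsub>G\<^esub> z \<otimes>\<^bsub>\<hh>\<^esub> \<phi> (\<gamma> [^]\<^bsub>G\<^esub> i) z' = \<zero>\<^bsub>\<hh>\<^esub>"
      using assms(5,10) z unfolding gamma_abelian_def diff by auto
    then show "z \<otimes>\<^bsub>\<hh>\<^esub> (\<phi> \<gamma> ^^ i) z' = \<zero>\<^bsub>\<hh>\<^esub>"
      using z differences_subset by (simp add: pow hom_LieAutGroup_one[OF assms(3,9)])
  qed
  \<comment> \<open>Closure under the bracket holds because all brackets of differences vanish and
    zero is a difference.\<close>
  have "lie_subalgebra K differences \<hh>"
    by (simp add: lie_subalgebra_def differences_submodule abelian differences_zero)
  then show ?thesis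
    unfolding inv diff
    using fixed_lie_subalgebra
    by (simp add: bracket_action lie_semidirect_sum_iso differences_bracket_fixed
        fixed_inter_differences fixed_plus_differences)
qed

end
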